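(* Let $\tilde L\in\mathbb{R}^{n\times n}$ be a standardized Laplacian matrix, let $J$ be the $n\times n$ matrix with all entries $1/n$, $P=\tilde L+J$ and $\tilde L_c=(I-J)-\tilde L$. Let $f_{\tilde L}(\lambda),f_P(\lambda),f_{\tilde L_c}(\lambda)$ be the characteristic polynomials $f_A(\lambda)=\det(\lambda I-A)$ of $\tilde L,P,\tilde L_c$ respectively. Then for all $\lambda\notin\{0,1\}$, $$f_P(\lambda)=\frac{\lambda-1}{\lambda}f_{\tilde L}(\lambda),\qquad f_{\tilde L_c}(\lambda)=(-1)^{n-1}\frac{\lambda}{1-\lambda}f_{\tilde L}(1-\lambda).$$
   Context: A standardized Laplacian matrix of order $n$ is a real matrix $\tilde L=(\ell_{ij})\in\mathbb{R}^{n\times n}$ such that $-\frac1n\le \ell_{ij}\le 0$ for all $j\ne i$ and $\sum_{j=1}^n \ell_{ij}=0$ for every $i$. $I$ is the $n\times n$ identity matrix. *)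

theory Defs
  imports Complex_Main "Jordan_Normal_Form.Char_Poly"
begin

definition standardized_laplacian :: "nat \<Rightarrow> real mat \<Rightarrow> bool" where
  "standardized_laplacian n L \<longleftrightarrow>
     L \<in> carrier_mat n n \<and>
     (\<forall>i<n. \<forall>j<n. j \<noteq> i \<longrightarrow> - (1 / real n) \<le> L $$ (i, j) \<and> L $$ (i, j) \<le> 0) \<and>
     (\<forall>i<n. (\<Sum>j<n. L $$ (i, j)) = 0)"

definition J_mat :: "nat \<Rightarrow> real mat" where
  "J_mat n = mat n n (\<lambda>(i, j). 1 / real n)"

text \<open>The characteristic polynomial of a real matrix, as a function of a complex variable.\<close>

definition char_fun :: "real mat \<Rightarrow> complex \<Rightarrow> complex" where
  "char_fun A z = poly (map_poly complex_of_real (char_poly A)) z"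

lemma char_fun_eq_det:
  assumes A: "A \<in> carrier_mat n n"
  shows "char_fun A z = det (z \<cdot>\<^sub>m 1\<^sub>m n - map_mat complex_of_real A)"
proof -
  have "char_fun A z = poly (char_poly (map_mat complex_of_real A)) z"
    unfolding char_fun_def of_real_hom.char_poly_hom[OF A] ..
  also have "\<dots> = det (z \<cdot>\<^sub>m 1\<^sub>m n - map_mat complex_of_real A)"
    unfolding char_poly_def
    by (rule poly_det_cong[of _ n], insert A, auto simp: char_poly_matrix_def)
  finally show ?thesis .
qed

end

theory Submission
  imports Defs
begin

text \<open>The all-ones column is an eigenvector of \<open>z I - L\<close> for the eigenvalue \<open>z\<close>, and \<open>J\<close> is that
  column (scaled by \<open>1/n\<close>) times the all-ones row. Subtracting from a matrix a rank-one matrix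
  whose column factor is an eigenvector changes only the corresponding eigenvalue, here from \<open>z\<close>
  to \<open>z - 1\<close>. The formula for \<open>Lc\<close> then follows from \<open>Lc = I - P\<close>.\<close>

text \<open>Both sides come from the bordered matrix with blocks \<open>A\<close>, \<open>c\<close>,
  \<open>r\<close>, \<open>1\<close>: clearing \<open>r\<close> leaves the Schur complement
  \<open>A - c * r\<close>, clearing \<open>c\<close> leaves \<open>A\<close> and a scalar. The
  eigenvector equation lets \<open>c / z\<close> stand in for the inverse of \<open>A\<close>
  applied to \<open>c\<close>, so a singular \<open>A\<close> is covered too.\<close>

lemma det_minus_eigenvector_mult_row:
  fixes A :: "'a :: field mat"
  assumes A: "A \<in> carrier_mat n n" and c: "c \<in> carrier_mat n 1" and r: "r \<in> carrier_mat 1 n"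
    and eig: "A * c = z \<cdot>\<^sub>m c" and z: "z \<noteq> 0"
  shows "z * det (A - c * r) = (z - (r * c) $$ (0, 0)) * det A"
proof -
  define M where "M = four_block_mat A c r (1\<^sub>m 1)"
  \<comment> \<open>Unit triangular column operations: \<open>E\<close> clears the lower left block
    of \<open>M\<close>, \<open>F\<close> the upper right one, and \<open>d\<close> is the corner
    that \<open>F\<close> leaves behind.\<close>
  define E where "E = four_block_mat (1\<^sub>m n) (0\<^sub>m n 1) (- r) (1\<^sub>m 1)"
  define F where "F = four_block_mat (1\<^sub>m n) (- inverse z \<cdot>\<^sub>m c) (0\<^sub>m 1 n) (1\<^sub>m 1)"
  define d where "d = 1\<^sub>m 1 - inverse z \<cdot>\<^sub>m (r * c)"
  have M: "M \<in> carrier_mat (n + 1) (n + 1)" and E: "E \<in> carrier_mat (n + 1) (n + 1)"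
    and F: "F \<in> carrier_mat (n + 1) (n + 1)" and d: "d \<in> carrier_mat 1 1"
    using A c r by (auto simp: M_def E_def F_def d_def)
  have detE: "det E = 1"
    unfolding E_def using r
    by (subst det_four_block_mat_upper_right_zero[of _ n _ 1]) auto
  have detF: "det F = 1"
    unfolding F_def using c
    by (subst det_four_block_mat_lower_left_zero[of _ n _ 1]) auto
  have cr: "A + c * (- r) = A - c * r" and rr: "r + - r = 0\<^sub>m 1 n"
    using A c r by auto
  have ME: "M * E = four_block_mat (A - c * r) c (0\<^sub>m 1 n) (1\<^sub>m 1)"
    unfolding M_def E_def using A c r cr rr
    by (subst mult_four_block_mat[of _ n n _ 1 _ 1 _ _ n _ 1]) auto
  have "A * (- inverse z \<cdot>\<^sub>m c) = - inverse z \<cdot>\<^sub>m (z \<cdot>\<^sub>m c)"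
    using A c eig by (subst mult_smult_distrib) auto
  also have "\<dots> = - c" using z by (intro eq_matI) auto
  finally have Ac: "A * (- inverse z \<cdot>\<^sub>m c) + c = 0\<^sub>m n 1" using c by auto
  have rc: "r * (- inverse z \<cdot>\<^sub>m c) + 1\<^sub>m 1 = d"
    using r c unfolding d_def by (subst mult_smult_distrib) auto
  have MF: "M * F = four_block_mat A (0\<^sub>m n 1) r d"
    unfolding M_def F_def using A c r Ac rc
    by (subst mult_four_block_mat[of _ n n _ 1 _ 1 _ _ n _ 1]) auto
  have "det (A - c * r) = det (M * E)"
    unfolding ME using A c r
    by (subst det_four_block_mat_lower_left_zero[of _ n _ 1]) auto
  also have "\<dots> = det (M * F)" using M E F detE detF by (simp add: det_mult)
  also have "\<dots> = det A * det d"
    unfolding MF using A r d by (subst det_four_block_mat_upper_right_zero[of _ n _ 1]) auto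
  also have "det d = 1 - (r * c) $$ (0, 0) / z"
    using r c unfolding d_def by (subst det_single) (auto simp: field_simps)
  finally show ?thesis using z by (simp add: field_simps)
qed

lemma char_fun_plus_J_mat:
  assumes n: "n \<ge> 1" and L: "standardized_laplacian n L" and z: "z \<noteq> 0"
  shows "char_fun (L + J_mat n) z = (z - 1) / z * char_fun L z"
proof -
  \<comment> \<open>Putting \<open>1 / n\<close> into the column gives
    \<open>c * r = J_mat n\<close>, while the entry of \<open>r * c\<close> is
    \<open>n * (1 / n) = 1\<close>; this is the shift from \<open>z\<close> to
    \<open>z - 1\<close>.\<close>
  define c :: "complex mat" where "c = mat n 1 (\<lambda>_. 1 / of_nat n)"
  define r :: "complex mat" where "r = mat 1 n (\<lambda>_. 1)"
  define A where "A = z \<cdot>\<^sub>m 1\<^sub>m n - map_mat complex_of_real L"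
  have Lc: "L \<in> carrier_mat n n" and row: "\<And>i. i < n \<Longrightarrow> (\<Sum>j<n. L $$ (i, j)) = 0"
    using L by (auto simp: standardized_laplacian_def)
  have A: "A \<in> carrier_mat n n" and c: "c \<in> carrier_mat n 1" and r: "r \<in> carrier_mat 1 n"
    using Lc by (auto simp: A_def c_def r_def)
  have "A * c = z \<cdot>\<^sub>m c"
  proof (rule eq_matI)
    fix i j assume "i < dim_row (z \<cdot>\<^sub>m c)" "j < dim_col (z \<cdot>\<^sub>m c)"
    then have i: "i < n" and j: "j = 0" by (auto simp: c_def)
    \<comment> \<open>The rows of \<open>L\<close> sum to 0, so only the diagonal \<open>z\<close>
      survives in the row sum of \<open>A\<close>.\<close>
    have "(\<Sum>k<n. A $$ (i, k)) = (\<Sum>k<n. if k = i then z else 0) - of_real (\<Sum>k<n. L $$ (i, k))"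
      unfolding of_real_sum sum_subtractf[symmetric]
      using i Lc by (intro sum.cong) (auto simp: A_def)
    then have "(\<Sum>k<n. A $$ (i, k)) = z" using i row by simp
    then have "(\<Sum>k<n. A $$ (i, k) / of_nat n) = z / of_nat n"
      by (simp add: sum_divide_distrib[symmetric])
    then show "(A * c) $$ (i, j) = (z \<cdot>\<^sub>m c) $$ (i, j)"
      using A i j by (simp add: c_def scalar_prod_def atLeast0LessThan)
  qed (use A in \<open>auto simp: c_def\<close>)
  from det_minus_eigenvector_mult_row[OF A c r this z]
  have "z * det (A - c * r) = (z - 1) * det A"
    using n by (simp add: c_def r_def scalar_prod_def)
  moreover have "A - c * r = z \<cdot>\<^sub>m 1\<^sub>m n - map_mat complex_of_real (L + J_mat n)"
    using Lc by (intro eq_matI) (auto simp: A_def c_def r_def J_mat_def scalar_prod_def)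
  moreover have "L + J_mat n \<in> carrier_mat n n" by (simp add: J_mat_def)
  ultimately show ?thesis
    using z by (simp add: char_fun_eq_det[OF Lc] char_fun_eq_det A_def field_simps)
qed

text \<open>\<open>z I - (I - A)\<close> is the negative of \<open>(1 - z) I - A\<close>, and each
  of the \<open>n\<close> rows contributes a factor -1 to the determinant.\<close>

lemma char_fun_one_minus:
  assumes A: "A \<in> carrier_mat n n"
  shows "char_fun (1\<^sub>m n - A) z = (-1) ^ n * char_fun A (1 - z)"
proof -
  have "z \<cdot>\<^sub>m 1\<^sub>m n - map_mat complex_of_real (1\<^sub>m n - A) =
      (-1) \<cdot>\<^sub>m ((1 - z) \<cdot>\<^sub>m 1\<^sub>m n - map_mat complex_of_real A)"
    using A by (intro eq_matI) auto
  moreover have "1\<^sub>m n - A \<in> carrier_mat n n" using A by auto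
  ultimately show ?thesis using A
    by (simp add: char_fun_eq_det[OF A] char_fun_eq_det det_smult)
qed

theorem theorem2:
  fixes n :: nat and L J P Lc :: "real mat"
  assumes "n \<ge> 1"
    and "standardized_laplacian n L"
    and "J = J_mat n"
    and "P = L + J"
    and "Lc = (1\<^sub>m n - J) - L"
  shows "\<forall>z::complex. z \<notin> {0, 1} \<longrightarrow>
           char_fun P z = (z - 1) / z * char_fun L z \<and>
           char_fun Lc z = (-1) ^ (n - 1) * (z / (1 - z)) * char_fun L (1 - z)"
proof (intro allI impI conjI)
  fix z :: complex assume z: "z \<notin> {0, 1}"
  show "char_fun P z = (z - 1) / z * char_fun L z"
    using assms z char_fun_plus_J_mat by simp
  have L: "L \<in> carrier_mat n n" using assms(2) by (simp add: standardized_laplacian_def)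
  then have P: "P \<in> carrier_mat n n" and Lc: "Lc = 1\<^sub>m n - P"
    using assms(3-5) by (auto simp: J_mat_def)
  \<comment> \<open>The formula for \<open>P\<close> is evaluated at \<open>1 - z\<close>, which is
    nonzero because \<open>z\<close> is not 1. Its numerator \<open>1 - z - 1 = - z\<close> supplies
    the sign that turns \<open>(-1) ^ n\<close> into \<open>(-1) ^ (n - 1)\<close>.\<close>
  have "char_fun Lc z = (-1) ^ n * ((1 - z - 1) / (1 - z) * char_fun L (1 - z))"
    using z char_fun_one_minus[OF P] char_fun_plus_J_mat[OF assms(1,2), of "1 - z"]
    by (simp add: Lc assms(3,4))
  also have "(-1 :: complex) ^ n = - ((-1) ^ (n - 1))"
    using assms(1) by (cases n) auto
  finally show "char_fun Lc z = (-1) ^ (n - 1) * (z / (1 - z)) * char_fun L (1 - z)"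
    by simp
qed

end
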